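(* Let $K\ge1$ and let $w_i,a_i,b_i$ ($i=1,\dots,K$) be the positive constants given in the context. For $\mathbf p=[p_1,\dots,p_K]^T$ with $p_i\ge0$ for all $i$ and $\mathbf p\ne0$ let $$J(\mathbf p)=\sum_{i=1}^{K}w_i\log_2\left(1+\frac{b_ip_i}{\sum_{j=1}^{K}a_jp_j}\right).$$ There is a unique positive real number $\nu^*$ such that the vector $\overline{\mathbf p}^*=[\overline p_1^*,\dots,\overline p_K^*]^T$ defined by $$\overline p_i^*=\max\left\{0,\ \frac{w_i}{\nu^*a_i}-\frac1{b_i}\right\},\qquad i=1,\dots,K,$$ satisfies $\sum_{i=1}^{K}a_i\overline p_i^*=1$. Moreover, with this $\nu^*$, the optimal solutions of $\max_{\mathbf p}J(\mathbf p)$ (over $\mathbf p$ with non-negative entries, $\mathbf p\neq0$) are exactly the vectors of the form $\mathbf p^*=c\,\overline{\mathbf p}^*$, where $c$ is any positive real number.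
   Context: The constants come from a multiuser downlink with $M\ge1$ base-station antennas, $K$ users, forward SNRs $\rho_i^f>0$, reverse SNRs $\rho_i^r>0$, weights $w_i>0$ and training length $\tau^r>0$: $$a_j=\left(\frac{\rho_j^r\tau^r}{1+\rho_j^r\tau^r}\right)^{-1},\qquad b_i=\frac{M\rho_i^f}{1+\rho_i^f(1+\rho_i^r\tau^r)^{-1}}.$$ In particular $a_i>0$ and $b_i>0$ for all $i$. *)

theory Defs
  imports "HOL-Analysis.Analysis"
begin

text \<open>
  The users are the elements of a finite type \<open>'k\<close>, so the number of users is
  \<open>CARD('k)\<close>, an arbitrary positive natural number. Power vectors have type \<open>real ^ 'k\<close>;
  the per-user parameters are functions on \<open>'k\<close>.
\<close>

text \<open>Here \<open>\<rho>f\<close>, \<open>\<rho>r\<close> are the forward and reverse SNRs, \<open>\<tau>\<close> is the training length and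
  \<open>M\<close> the number of base-station antennas.\<close>

definition a_coeff :: "real \<Rightarrow> ('k \<Rightarrow> real) \<Rightarrow> 'k \<Rightarrow> real" where
  "a_coeff \<tau> \<rho>r j = inverse (\<rho>r j * \<tau> / (1 + \<rho>r j * \<tau>))"

definition b_coeff :: "nat \<Rightarrow> real \<Rightarrow> ('k \<Rightarrow> real) \<Rightarrow> ('k \<Rightarrow> real) \<Rightarrow> 'k \<Rightarrow> real" where
  "b_coeff M \<tau> \<rho>f \<rho>r i = real M * \<rho>f i / (1 + \<rho>f i * inverse (1 + \<rho>r i * \<tau>))"

definition weighted_rate ::
  "('k::finite \<Rightarrow> real) \<Rightarrow> ('k \<Rightarrow> real) \<Rightarrow> ('k \<Rightarrow> real) \<Rightarrow> real ^ 'k \<Rightarrow> real" where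
  "weighted_rate w a b p =
     (\<Sum>i\<in>UNIV. w i * log 2 (1 + b i * p $ i / (\<Sum>j\<in>UNIV. a j * p $ j)))"

definition feasible :: "real ^ 'k::finite \<Rightarrow> bool" where
  "feasible p \<longleftrightarrow> (\<forall>i. 0 \<le> p $ i) \<and> p \<noteq> 0"

definition pbar ::
  "('k::finite \<Rightarrow> real) \<Rightarrow> ('k \<Rightarrow> real) \<Rightarrow> ('k \<Rightarrow> real) \<Rightarrow> real \<Rightarrow> real ^ 'k" where
  "pbar w a b \<nu> = (\<chi> i. max 0 (w i / (\<nu> * a i) - 1 / b i))"

end

theory Submission imports Defs begin

text \<open>
  The rate is invariant under positive scaling, so it suffices to maximise it on the simplex
  \<open>\<Sum>j. a j * q $ j = 1\<close>, where it is a sum of strictly concave functions of the single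
  coordinates. Replacing each logarithm by its tangent at the water-filling point, the slopes are
  at most \<open>\<nu> * a i\<close>, with equality on the support of that point; the linear terms therefore sum
  to at most zero. The water level is found by the intermediate value theorem in \<open>1 / \<nu>\<close>.
\<close>

text \<open>The strictness comes from the equality case of \<open>ln t \<le> t - 1\<close> and later
  makes the maximiser unique up to scaling.\<close>

lemma ln_less_tangent:
  fixes x y :: real
  assumes "0 < x" "0 < y" "x \<noteq> y"
  shows "ln y < ln x + (y - x) / x"
proof -
  have "ln (y / x) < y / x - 1"
    using assms ln_le_minus_one[of "y / x"] ln_eq_minus_one[of "y / x"] by fastforce
  then show ?thesis
    using assms by (simp add: ln_div diff_divide_distrib)
qed

text \<open>No term decreases in \<open>x\<close>, and a term that is positive at \<open>x\<close>
  grows strictly. Positivity of the sum supplies such a term; it excludes the range where every term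
  is cut off at 0.\<close>

lemma sum_max_affine_strict_mono:
  fixes w c :: "'k::finite \<Rightarrow> real"
  assumes "\<And>i. 0 < w i" "x < y" "0 < (\<Sum>i\<in>UNIV. max 0 (x * w i - c i))"
  shows "(\<Sum>i\<in>UNIV. max 0 (x * w i - c i)) < (\<Sum>i\<in>UNIV. max 0 (y * w i - c i))"
proof (rule sum_strict_mono_ex1)
  have less: "x * w i < y * w i" for i
    using assms by simp
  show "\<forall>i\<in>UNIV. max 0 (x * w i - c i) \<le> max 0 (y * w i - c i)"
    using less by (smt (verit))
  obtain i where "max 0 (x * w i - c i) > 0"
    using assms(3) sum_nonpos[of UNIV "\<lambda>i. max 0 (x * w i - c i)"] by (meson not_le)
  then show "\<exists>i\<in>UNIV. max 0 (x * w i - c i) < max 0 (y * w i - c i)"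
    using less[of i] by (intro bexI[of _ i]) auto
qed simp

lemma ex1_sum_max_affine_eq_1:
  fixes w c :: "'k::finite \<Rightarrow> real"
  assumes w: "\<And>i. 0 < w i" and c: "\<And>i. 0 < c i"
  shows "\<exists>!x. 0 < x \<and> (\<Sum>i\<in>UNIV. max 0 (x * w i - c i)) = 1"
proof -
  let ?h = "\<lambda>x. \<Sum>i\<in>UNIV. max 0 (x * w i - c i)"
  fix k :: 'k
  \<comment> \<open>At \<open>?B\<close> the term of the arbitrary index \<open>k\<close> alone
    equals 1, so the whole sum has reached the target value.\<close>
  let ?B = "(1 + c k) / w k"
  have h0: "?h 0 = 0"
    using c by (simp add: max_absorb1 less_imp_le)
  have "max 0 (?B * w k - c k) \<le> ?h ?B"
    by (rule member_le_sum) auto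
  then have hB: "1 \<le> ?h ?B"
    using w[of k] by simp
  have "\<exists>x\<ge>0. x \<le> ?B \<and> ?h x = 1"
    using w[of k] c[of k] h0 hB by (intro IVT') (auto intro!: continuous_intros)
  then obtain x where x: "0 \<le> x" "?h x = 1" by blast
  with h0 have "0 < x" by (cases "x = 0") auto
  \<comment> \<open>Whichever point is smaller, the sum there is 1, hence positive, and strict
    growth contradicts the equal value at the larger point.\<close>
  moreover have "y = x" if "?h y = 1" for y
    using sum_max_affine_strict_mono[where w = w and c = c and x = x and y = y]
      sum_max_affine_strict_mono[where w = w and c = c and x = y and y = x]
      w x that by (cases x y rule: linorder_cases) auto
  ultimately show ?thesis
    using x by blast
qed

text \<open>Pulling the weight \<open>a i\<close> inside the maximum makes each term a truncated
  affine function of \<open>1 / \<nu>\<close>, with offset \<open>a i / b i\<close>.\<close>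

lemma sum_pbar:
  fixes w a b :: "'k::finite \<Rightarrow> real"
  assumes a: "\<And>i. 0 < a i"
  shows "(\<Sum>i\<in>UNIV. a i * pbar w a b \<nu> $ i) =
         (\<Sum>i\<in>UNIV. max 0 (inverse \<nu> * w i - a i / b i))"
proof (rule sum.cong[OF refl])
  fix i
  have "a i * max 0 (w i / (\<nu> * a i) - 1 / b i) =
      max (a i * 0) (a i * (w i / (\<nu> * a i) - 1 / b i))"
    using a[of i] by (simp add: max_mult_distrib_left)
  also have "a i * (w i / (\<nu> * a i) - 1 / b i) = inverse \<nu> * w i - a i / b i"
    using a[of i] by (simp add: right_diff_distrib divide_inverse)
  finally show "a i * pbar w a b \<nu> $ i = max 0 (inverse \<nu> * w i - a i / b i)"
    by (simp add: pbar_def)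
qed

lemma ex1_water_level:
  fixes w a b :: "'k::finite \<Rightarrow> real"
  assumes "\<And>i. 0 < w i" "\<And>i. 0 < a i" "\<And>i. 0 < b i"
  shows "\<exists>!\<nu>. 0 < \<nu> \<and> (\<Sum>i\<in>UNIV. a i * pbar w a b \<nu> $ i) = 1"
proof -
  have "\<exists>!x. 0 < x \<and> (\<Sum>i\<in>UNIV. max 0 (x * w i - a i / b i)) = 1"
    using assms by (intro ex1_sum_max_affine_eq_1) simp_all
  then obtain x where x: "0 < x" "(\<Sum>i\<in>UNIV. max 0 (x * w i - a i / b i)) = 1"
    and uniq: "\<And>y. 0 < y \<and> (\<Sum>i\<in>UNIV. max 0 (y * w i - a i / b i)) = 1 \<Longrightarrow> y = x"
    by blast
  show ?thesis
    unfolding sum_pbar[OF assms(2)]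
  \<comment> \<open>Inversion is a bijection of the positive reals, so existence and uniqueness
    carry over from \<open>x\<close> to \<open>\<nu>\<close>.\<close>
  proof (rule ex1I[of _ "inverse x"])
    show "0 < inverse x \<and> (\<Sum>i\<in>UNIV. max 0 (inverse (inverse x) * w i - a i / b i)) = 1"
      using x by simp
    show "\<nu> = inverse x"
      if "0 < \<nu> \<and> (\<Sum>i\<in>UNIV. max 0 (inverse \<nu> * w i - a i / b i)) = 1" for \<nu>
      using uniq[of "inverse \<nu>"] that by auto
  qed
qed

text \<open>These are the Karush-Kuhn-Tucker conditions with multiplier \<open>\<nu>\<close>: the
  derivative of \<open>w i * ln (1 + b i * z)\<close> at \<open>z = x\<close> is at most
  \<open>\<nu> * a i\<close>, with equality if \<open>x > 0\<close>. If \<open>x = 0\<close>, then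
  \<open>q - x\<close> is non-negative, so the bound on the slope may be multiplied by it.\<close>

lemma pbar_slope:
  fixes w a b :: "'k::finite \<Rightarrow> real"
  assumes "0 < \<nu>" "0 < a i" "0 < b i" "0 < w i" "0 \<le> q"
  defines "x \<equiv> pbar w a b \<nu> $ i"
  shows "w i * (b i * (q - x) / (1 + b i * x)) \<le> \<nu> * (a i * (q - x))"
proof (cases "w i / (\<nu> * a i) - 1 / b i \<le> 0")
  case True
  then have "x = 0" by (simp add: x_def pbar_def)
  moreover have "w i * b i \<le> \<nu> * a i"
    using True assms by (simp add: field_simps)
  then have "w i * b i * q \<le> \<nu> * a i * q"
    using assms(5) by (rule mult_right_mono)
  ultimately show ?thesis by (simp add: mult.assoc)
next
  case False
  then have "x = w i / (\<nu> * a i) - 1 / b i" by (simp add: x_def pbar_def)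
  \<comment> \<open>Here the slope is exactly \<open>\<nu> * a i\<close>, so both sides agree
    whatever the sign of \<open>q - x\<close>.\<close>
  then have "1 + b i * x = b i * w i / (\<nu> * a i)"
    using assms by (simp add: right_diff_distrib)
  then show ?thesis
    using assms(1-4) by simp
qed

lemma weighted_rate_less_pbar:
  fixes w a b :: "'k::finite \<Rightarrow> real"
  assumes pos: "\<And>i. 0 < w i" "\<And>i. 0 < a i" "\<And>i. 0 < b i"
    and \<nu>: "0 < \<nu>" "(\<Sum>i\<in>UNIV. a i * pbar w a b \<nu> $ i) = 1"
    and q: "\<And>i. 0 \<le> q $ i" "(\<Sum>i\<in>UNIV. a i * q $ i) = 1" "q \<noteq> pbar w a b \<nu>"
  shows "weighted_rate w a b q < weighted_rate w a b (pbar w a b \<nu>)"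
proof -
  let ?x = "pbar w a b \<nu>"
  have x0: "0 \<le> ?x $ i" for i by (simp add: pbar_def)
  have p1: "0 < 1 + b i * z" if "0 \<le> z" for i z
    using pos(3)[of i] that by (simp add: add_pos_nonneg)
  have tangent: "w i * ln (1 + b i * q $ i)
      < w i * ln (1 + b i * ?x $ i) + \<nu> * (a i * (q $ i - ?x $ i))"
    if "q $ i \<noteq> ?x $ i" for i
  proof -
    have "ln (1 + b i * q $ i) <
        ln (1 + b i * ?x $ i) + b i * (q $ i - ?x $ i) / (1 + b i * ?x $ i)"
      using ln_less_tangent[OF p1[OF x0[of i], of i] p1[OF q(1)[of i], of i]] that pos(3)[of i]
      by (simp add: right_diff_distrib)
    then have "w i * ln (1 + b i * q $ i) <
        w i * (ln (1 + b i * ?x $ i) + b i * (q $ i - ?x $ i) / (1 + b i * ?x $ i))"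
      using pos(1)[of i] by (rule mult_strict_left_mono)
    also have "\<dots> \<le> w i * ln (1 + b i * ?x $ i) + \<nu> * (a i * (q $ i - ?x $ i))"
      using pbar_slope[OF \<nu>(1) pos(2) pos(3) pos(1) q(1)] by (simp add: distrib_left)
    finally show ?thesis .
  qed
  \<comment> \<open>One differing coordinate makes the summed tangent bound strict.\<close>
  obtain k where k: "q $ k \<noteq> ?x $ k"
    using q(3) by (auto simp: vec_eq_iff)
  have "(\<Sum>i\<in>UNIV. w i * ln (1 + b i * q $ i)) <
      (\<Sum>i\<in>UNIV. w i * ln (1 + b i * ?x $ i) + \<nu> * (a i * (q $ i - ?x $ i)))"
  proof (rule sum_strict_mono_ex1)
    show "\<forall>i\<in>UNIV. w i * ln (1 + b i * q $ i)
        \<le> w i * ln (1 + b i * ?x $ i) + \<nu> * (a i * (q $ i - ?x $ i))"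
    proof
      fix i
      show "w i * ln (1 + b i * q $ i)
          \<le> w i * ln (1 + b i * ?x $ i) + \<nu> * (a i * (q $ i - ?x $ i))"
        using tangent[of i] by (cases "q $ i = ?x $ i") auto
    qed
  qed (use tangent[OF k] in auto)
  \<comment> \<open>The linear corrections add up to \<open>\<nu>\<close> times the difference of
    two weighted sums, both equal to 1.\<close>
  also have "\<dots> = (\<Sum>i\<in>UNIV. w i * ln (1 + b i * ?x $ i))
      + \<nu> * ((\<Sum>i\<in>UNIV. a i * q $ i) - (\<Sum>i\<in>UNIV. a i * ?x $ i))"
    by (simp add: sum.distrib sum_subtractf right_diff_distrib sum_distrib_left)
  also have "\<dots> = (\<Sum>i\<in>UNIV. w i * ln (1 + b i * ?x $ i))"
    using q(2) \<nu>(2) by simp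
  \<comment> \<open>The normalised sums remove the denominators in the rate, and division by
    \<open>ln 2\<close> passes from \<open>ln\<close> to \<open>log 2\<close>.\<close>
  finally show ?thesis
    by (simp add: weighted_rate_def q(2) \<nu>(2) log_def divide_strict_right_mono
        flip: sum_divide_distrib)
qed

lemma weighted_rate_scaleR:
  assumes "c \<noteq> 0"
  shows "weighted_rate w a b (c *\<^sub>R p) = weighted_rate w a b p"
proof -
  have "(\<Sum>j\<in>UNIV. a j * (c *\<^sub>R p) $ j) = c * (\<Sum>j\<in>UNIV. a j * p $ j)"
    by (simp add: sum_distrib_left mult.left_commute)
  then show ?thesis
    using assms by (simp add: weighted_rate_def mult.left_commute[of _ c])
qed

text \<open>This allows a feasible vector to be rescaled onto the simplex.\<close>

lemma feasible_sum_pos: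
  assumes "feasible p" "\<And>i. 0 < a i"
  shows "0 < (\<Sum>i\<in>UNIV. a i * p $ i)"
proof -
  obtain k where "p $ k \<noteq> 0" and nonneg: "\<And>i. 0 \<le> p $ i"
    using assms(1) by (auto simp: feasible_def vec_eq_iff)
  then have "0 < p $ k" by (simp add: less_le)
  then show ?thesis
    using assms(2) nonneg by (intro sum_pos2[of _ k]) (auto intro: mult_nonneg_nonneg less_imp_le)
qed

lemma feasible_scaleR:
  assumes "feasible p" "0 < c"
  shows "feasible (c *\<^sub>R p)"
  using assms by (simp add: feasible_def)

lemma arg_max_weighted_rate:
  fixes w a b :: "'k::finite \<Rightarrow> real"
  assumes pos: "\<And>i. 0 < w i" "\<And>i. 0 < a i" "\<And>i. 0 < b i"
    and \<nu>: "0 < \<nu>" "(\<Sum>i\<in>UNIV. a i * pbar w a b \<nu> $ i) = 1"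
  shows "{p. is_arg_max (weighted_rate w a b) feasible p} =
           {c *\<^sub>R pbar w a b \<nu> | c. c > 0}"
proof -
  let ?x = "pbar w a b \<nu>" and ?J = "weighted_rate w a b"
  have x: "feasible ?x"
  proof -
    have "?x \<noteq> 0"
      using \<nu>(2) by (intro notI) simp
    then show ?thesis by (simp add: feasible_def pbar_def)
  qed
  \<comment> \<open>Strict loss off the ray through \<open>?x\<close> puts every maximiser on the
    ray; scale invariance then makes every point of the ray a maximiser.\<close>
  have less: "?J p < ?J ?x" if p: "feasible p" and ne: "\<nexists>c. c > 0 \<and> p = c *\<^sub>R ?x" for p
  proof -
    define s where "s = (\<Sum>i\<in>UNIV. a i * p $ i)"
    have s: "0 < s"
      unfolding s_def by (rule feasible_sum_pos[OF p pos(2)])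
    define q where "q = inverse s *\<^sub>R p"
    have p_eq: "p = s *\<^sub>R q"
      using s by (simp add: q_def)
    have "(\<Sum>i\<in>UNIV. a i * q $ i) = inverse s * s"
      by (simp add: q_def s_def sum_distrib_left mult.left_commute)
    moreover have "\<And>i. 0 \<le> q $ i"
      using p s by (simp add: q_def feasible_def)
    \<comment> \<open>Otherwise \<open>p = s *\<^sub>R ?x\<close> would lie on the ray.\<close>
    moreover have "q \<noteq> ?x"
      using ne s p_eq by blast
    ultimately have "?J q < ?J ?x"
      using s by (intro weighted_rate_less_pbar[OF pos \<nu>]) auto
    then show ?thesis
      using s by (simp add: p_eq weighted_rate_scaleR)
  qed
  have le: "?J p \<le> ?J ?x" if "feasible p" for p
  proof (cases "\<exists>c. c > 0 \<and> p = c *\<^sub>R ?x")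
    case True
    then show ?thesis by (auto simp: weighted_rate_scaleR)
  qed (use less[OF that] in simp)
  show ?thesis
  proof (intro equalityI subsetI)
    fix p assume "p \<in> {p. is_arg_max ?J feasible p}"
    then have "feasible p" "\<not> ?J p < ?J ?x"
      using x by (auto simp: is_arg_max_def)
    then show "p \<in> {c *\<^sub>R ?x | c. c > 0}"
      using less[of p] by blast
  next
    fix p assume "p \<in> {c *\<^sub>R ?x | c. c > 0}"
    then show "p \<in> {p. is_arg_max ?J feasible p}"
      using le x by (auto simp: is_arg_max_def weighted_rate_scaleR feasible_scaleR not_less)
  qed
qed

theorem theorem2:
  fixes M :: nat and \<tau> :: real
    and \<rho>f \<rho>r w a b :: "'k::finite \<Rightarrow> real"
  assumes "M \<ge> 1" and "\<tau> > 0"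
    and "\<And>i. \<rho>f i > 0" and "\<And>i. \<rho>r i > 0" and "\<And>i. w i > 0"
    and "a = a_coeff \<tau> \<rho>r" and "b = b_coeff M \<tau> \<rho>f \<rho>r"
  shows "(\<exists>!\<nu>. \<nu> > 0 \<and> (\<Sum>i\<in>UNIV. a i * pbar w a b \<nu> $ i) = 1) \<and>
         (\<forall>\<nu>. \<nu> > 0 \<and> (\<Sum>i\<in>UNIV. a i * pbar w a b \<nu> $ i) = 1 \<longrightarrow>
            {p. is_arg_max (weighted_rate w a b) feasible p} =
              {c *\<^sub>R pbar w a b \<nu> | c. c > 0})"
proof -
  have a: "0 < a i" for i
    using assms(2) assms(4)[of i] by (simp add: assms(6) a_coeff_def add_pos_pos)
  have b: "0 < b i" for i
    using assms(1,2) assms(3,4)[of i]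
    by (auto simp: assms(7) b_coeff_def intro!: divide_pos_pos mult_pos_pos add_pos_pos)
  show ?thesis
    by (intro conjI allI impI ex1_water_level arg_max_weighted_rate assms(5) a b) simp_all
qed

end
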